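(* Let $k \ge 2$ and $n \ge k+1$ be integers. Assume that $\mathcal{A} \subset 2^{[n]}$ contains neither $Y_k$ nor $Y_k'$ as a subposet, and that $\varnothing \notin \mathcal{A}$ and $[n] \notin \mathcal{A}$. Then $$\sum_{A\in \mathcal{A}} \frac{1}{\binom{n}{|A|}} \le k.$$
   Context: $[n]=\{1,\dots,n\}$ and $2^{[n]}$ is its power set. A family $\mathcal{A}\subset 2^{[n]}$ is viewed as a poset under inclusion. A poset $P$ is a (weak) subposet of a poset $Q$ if there is an injection $\phi:P\to Q$ such that $x\le y$ in $P$ implies $\phi(x)\le\phi(y)$ in $Q$; "subposet" means weak subposet. $Y_k$ is the poset on $k+2$ distinct elements $x_1,\dots,x_k,y,z$ whose order is generated by $x_1\le x_2\le\dots\le x_k$, $x_k\le y$ and $x_k\le z$. $Y_k'$ is the poset obtained from $Y_k$ by reversing all relations. *)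

theory Defs
  imports Complex_Main
begin

text \<open>A poset is given by a carrier set together with a relation satisfying
  \<^const>\<open>partial_order_on\<close> on that carrier.\<close>

definition weak_subposet :: "'a set \<Rightarrow> 'a rel \<Rightarrow> 'b set \<Rightarrow> 'b rel \<Rightarrow> bool" where
  "weak_subposet P r Q s \<longleftrightarrow>
    (\<exists>\<phi>. inj_on \<phi> P \<and> \<phi> ` P \<subseteq> Q \<and>
         (\<forall>x\<in>P. \<forall>y\<in>P. (x, y) \<in> r \<longrightarrow> (\<phi> x, \<phi> y) \<in> s))"

text \<open>\<open>Stem i\<close> is $x_i$; the two tips are $y$ and $z$.\<close>

datatype Y_elem = Stem nat | Tip_y | Tip_z

definition Y_carrier :: "nat \<Rightarrow> Y_elem set" where
  "Y_carrier k = Stem ` {1..k} \<union> {Tip_y, Tip_z}"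

definition Y_gen :: "nat \<Rightarrow> Y_elem rel" where
  "Y_gen k = {(Stem i, Stem (Suc i)) |i. 1 \<le> i \<and> i < k} \<union>
             {(Stem k, Tip_y), (Stem k, Tip_z)}"

text \<open>The closure \<open>\<^sup>*\<close> is reflexive on the whole type, hence the restriction to the carrier.\<close>

definition Y_order :: "nat \<Rightarrow> Y_elem rel" where
  "Y_order k = (Y_gen k)\<^sup>* \<inter> (Y_carrier k \<times> Y_carrier k)"

lemma partial_order_on_Y_order: "partial_order_on (Y_carrier k) (Y_order k)"
proof -
  define h where "h e = (case e of Stem i \<Rightarrow> i | _ \<Rightarrow> Suc k)" for e
  have gen: "h x < h y" if "(x, y) \<in> Y_gen k" for x y
    using that by (auto simp: Y_gen_def h_def)
  have closure: "x = y \<or> h x < h y" if "(x, y) \<in> (Y_gen k)\<^sup>*" for x y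
    using that by induction (auto dest: gen)
  have "antisym ((Y_gen k)\<^sup>*)"
    by (rule antisymI) (metis closure less_asym)
  then show ?thesis
    unfolding partial_order_on_def preorder_on_def Y_order_def
    by (auto simp: refl_on_def antisym_def trans_def)
qed

definition contains_Y :: "'a set set \<Rightarrow> nat \<Rightarrow> bool" where
  "contains_Y \<A> k \<longleftrightarrow>
    weak_subposet (Y_carrier k) (Y_order k) \<A> (relation_of (\<subseteq>) \<A>)"

definition contains_Y_dual :: "'a set set \<Rightarrow> nat \<Rightarrow> bool" where
  "contains_Y_dual \<A> k \<longleftrightarrow>
    weak_subposet (Y_carrier k) ((Y_order k)\<inverse>) \<A> (relation_of (\<subseteq>) \<A>)"

end

theory Submission
  imports Defs "HOL-Combinatorics.Permutations"
begin

text \<open>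
  Count pairs of a full chain \<open>\<emptyset> \<subset> \<dots> \<subset> {1..n}\<close> and a member of \<open>\<A>\<close> on it. A set \<open>A\<close> lies on
  the fraction \<open>1 / (n choose card A)\<close> of all full chains, so the claim says that a full chain
  carries at most \<open>k\<close> members of \<open>\<A>\<close> on average.

  Some chains may carry more, but these are very special. Let \<open>c\<^sub>1 \<subset> c\<^sub>2 \<subset> \<dots>\<close> be the members on
  a chain, and suppose that there are more than \<open>k\<close> of them. Since there is no \<open>Y\<^sub>k\<close>, only one
  member \<open>E\<close> of the whole family \<open>\<A>\<close> lies strictly above \<open>D = c\<^sub>k\<close>; since there is no dual \<open>Y\<^sub>k\<close>,
  only one member \<open>C\<close> lies strictly below \<open>B = c\<^sub>2\<close>. Call such a pair \<open>B \<subseteq> D\<close> on a chain, with exactly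
  \<open>k - 1\<close> members on the chain from \<open>B\<close> to \<open>D\<close>, a spine of the chain (lemma \<open>spine_exists\<close>). Now
  keep the part of the chain between \<open>B\<close> and \<open>D\<close> and let the rest vary. The chain then carries
  \<open>k - 1\<close> members, plus one if it meets \<open>C\<close>, plus one if it meets \<open>E\<close> (lemma \<open>spine_count\<close>). As \<open>C\<close>
  is not empty, exchanging the set of size \<open>card C\<close> for the other set that fits between its two
  neighbours on the chain turns a chain through \<open>C\<close> into one that avoids \<open>C\<close> and has the same
  spine. A chain has only one spine (lemma \<open>spine_unique\<close>), so the exchange can be undone, and at
  most half of the chains with a spine pass through their \<open>C\<close>. As \<open>E\<close> is not the full set, the same
  holds for \<open>E\<close> (lemma \<open>card_through_le_half\<close>). Hence the chains with a spine carry at most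
  \<open>k - 1 + 1/2 + 1/2 = k\<close> members on average, and every other chain carries at most \<open>k\<close>.

  Full chains are represented by permutations \<open>\<pi>\<close> of \<open>{1..n}\<close>, the chain of \<open>\<pi>\<close> consisting of the
  images of the initial segments \<open>{1..i}\<close>; the exchange is then an adjacent transposition.
\<close>

section \<open>Full chains as permutations\<close>

definition initial :: "(nat \<Rightarrow> nat) \<Rightarrow> nat \<Rightarrow> nat set" where
  "initial \<pi> i = \<pi> ` {1..i}"

lemma card_initial: "\<pi> permutes S \<Longrightarrow> card (initial \<pi> i) = i"
  unfolding initial_def by (subst card_image) (auto intro: permutes_inj_on)

lemma initial_subset: "\<pi> permutes {1..n} \<Longrightarrow> i \<le> n \<Longrightarrow> initial \<pi> i \<subseteq> {1..n}"
  unfolding initial_def using permutes_image[of \<pi> "{1..n}"] by (auto simp: permutes_in_image)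

lemma initial_mono: "i \<le> j \<Longrightarrow> initial \<pi> i \<subseteq> initial \<pi> j"
  by (auto simp: initial_def)

lemma initial_strict_mono:
  assumes "\<pi> permutes S" "i < j"
  shows "initial \<pi> i \<subset> initial \<pi> j"
  using initial_mono[of i j \<pi>] card_initial[OF assms(1)] assms(2)
  by (metis less_imp_le nat_neq_iff psubsetI)

lemma initial_transpose_neq:
  assumes "1 \<le> i" "j \<noteq> i"
  shows "initial (\<pi> \<circ> transpose i (Suc i)) j = initial \<pi> j"
proof -
  have "transpose i (Suc i) ` {1..j} = {1..j}"
    using assms by (intro transpose_image_eq) auto
  then show ?thesis
    by (simp only: initial_def image_comp [symmetric])
qed

lemma initial_transpose_changes:
  assumes "\<pi> permutes S" "1 \<le> i"
  shows "initial (\<pi> \<circ> transpose i (Suc i)) i \<noteq> initial \<pi> i"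
proof -
  have "\<pi> (Suc i) \<in> initial (\<pi> \<circ> transpose i (Suc i)) i"
    using assms(2) unfolding initial_def by (intro image_eqI[of _ _ i]) auto
  moreover have "\<pi> (Suc i) \<notin> initial \<pi> i"
    using permutes_inj[OF assms(1)] by (auto simp: initial_def inj_eq)
  ultimately show ?thesis by metis
qed

text \<open>Relabelling the ground set shows that all sets of the same size lie on equally many full
  chains, and each full chain contains exactly one set of each size.\<close>

lemma card_permutes_initial_le:
  assumes "A \<subseteq> {1..n}" "B \<subseteq> {1..n}" "card A = card B"
  shows "card {\<pi>. \<pi> permutes {1..n} \<and> initial \<pi> m = A} \<le>
         card {\<pi>. \<pi> permutes {1..n} \<and> initial \<pi> m = B}"
proof -
  have fin: "finite A" "finite B"
    using assms finite_subset by blast+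
  obtain f where f: "bij_betw f A B"
    using fin assms(3) finite_same_card_bij by blast
  have "card ({1..n} - A) = card ({1..n} - B)"
    using assms fin by (simp add: card_Diff_subset)
  then obtain g where g: "bij_betw g ({1..n} - A) ({1..n} - B)"
    by (meson finite_Diff finite_atLeastAtMost finite_same_card_bij)
  define \<sigma> where "\<sigma> x = (if x \<in> A then f x else if x \<in> {1..n} then g x else x)" for x
  have "bij_betw \<sigma> A B"
    using f by (subst bij_betw_cong[where g = f]) (auto simp: \<sigma>_def)
  moreover have "bij_betw \<sigma> ({1..n} - A) ({1..n} - B)"
    using g by (subst bij_betw_cong[where g = g]) (auto simp: \<sigma>_def)
  ultimately have "bij_betw \<sigma> (A \<union> ({1..n} - A)) (B \<union> ({1..n} - B))"
    by (rule bij_betw_combine) auto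
  moreover have "A \<union> ({1..n} - A) = {1..n}" "B \<union> ({1..n} - B) = {1..n}"
    using assms by auto
  ultimately have \<sigma>: "\<sigma> permutes {1..n}"
    using assms(1) by (intro bij_imp_permutes) (auto simp: \<sigma>_def)
  have img: "\<sigma> ` A = B"
    using \<open>bij_betw \<sigma> A B\<close> by (simp add: bij_betw_def)
  show ?thesis
  proof (rule card_inj_on_le[where f = "\<lambda>\<pi>. \<sigma> \<circ> \<pi>"])
    show "inj_on (\<lambda>\<pi>. \<sigma> \<circ> \<pi>) {\<pi>. \<pi> permutes {1..n} \<and> initial \<pi> m = A}"
      using permutes_inj[OF \<sigma>] by (auto simp: inj_on_def fun_eq_iff dest: injD)
    show "(\<lambda>\<pi>. \<sigma> \<circ> \<pi>) ` {\<pi>. \<pi> permutes {1..n} \<and> initial \<pi> m = A}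
        \<subseteq> {\<pi>. \<pi> permutes {1..n} \<and> initial \<pi> m = B}"
      using \<sigma> img by (auto intro: permutes_compose simp: initial_def image_comp [symmetric])
    show "finite {\<pi>. \<pi> permutes {1..n} \<and> initial \<pi> m = B}"
      by (rule finite_subset[OF _ finite_permutations[of "{1..n}"]]) auto
  qed
qed

lemma card_permutes_initial:
  assumes "A \<subseteq> {1..n}"
  shows "card {\<pi>. \<pi> permutes {1..n} \<and> initial \<pi> (card A) = A} * (n choose card A) = fact n"
proof -
  let ?m = "card A"
  let ?S = "{\<pi>. \<pi> permutes {1..n}}"
  let ?N = "\<lambda>B. {\<pi>. \<pi> permutes {1..n} \<and> initial \<pi> ?m = B}"
  let ?L = "{B. B \<subseteq> {1..n} \<and> card B = ?m}"
  have m: "?m \<le> n"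
    using card_mono[OF _ assms] by simp
  have fin: "finite ?S" by (simp add: finite_permutations)
  have union: "?S = (\<Union>B\<in>?L. ?N B)"
    using initial_subset m card_initial by fastforce
  have "fact n = card ?S"
    using card_permutations[of "{1..n}" n] by simp
  also have "\<dots> = card (\<Union>B\<in>?L. ?N B)"
    by (rule arg_cong[OF union])
  also have "\<dots> = (\<Sum>B\<in>?L. card (?N B))"
    by (rule card_UN_disjoint) (auto intro: finite_subset[OF _ fin])
  also have "\<dots> = (\<Sum>B\<in>?L. card (?N A))"
    using assms by (intro sum.cong refl antisym card_permutes_initial_le) auto
  also have "\<dots> = card (?N A) * card ?L"
    by simp
  also have "card ?L = n choose ?m"
    using n_subsets[of "{1..n}"] by simp
  finally show ?thesis by simp
qed

text \<open>Double counting turns the weighted sum into the average number of members on a full chain.\<close>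

lemma sum_inverse_choose_eq_average:
  fixes \<A> :: "nat set set"
  assumes "\<A> \<subseteq> Pow {1..n}"
  shows "(\<Sum>A\<in>\<A>. 1 / real (n choose card A)) =
    real (\<Sum>\<pi> | \<pi> permutes {1..n}. card {i. i \<le> n \<and> initial \<pi> i \<in> \<A>}) / fact n"
proof -
  let ?S = "{\<pi>. \<pi> permutes {1..n}}"
  have finS: "finite ?S" by (simp add: finite_permutations)
  have finA: "finite \<A>" using assms finite_subset by blast
  have sz: "card A \<le> n" if "A \<in> \<A>" for A
    using card_mono[of "{1..n}" A] that assms by auto
  have members: "card {i. i \<le> n \<and> initial \<pi> i \<in> \<A>} = card {A\<in>\<A>. initial \<pi> (card A) = A}"
    if "\<pi> permutes {1..n}" for \<pi>
    by (rule bij_betw_same_card[where f = "initial \<pi>"], rule bij_betwI[where g = card])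
       (auto simp: card_initial[OF that] sz)
  have "1 / real (n choose card A) =
      real (card {\<pi>\<in>?S. initial \<pi> (card A) = A}) / fact n" if "A \<in> \<A>" for A
  proof -
    have "A \<subseteq> {1..n}" using that assms by auto
    then have "card {\<pi>\<in>?S. initial \<pi> (card A) = A} * (n choose card A) = fact n"
      using card_permutes_initial by simp
    then have "real (card {\<pi>\<in>?S. initial \<pi> (card A) = A}) * real (n choose card A) = fact n"
      by (metis of_nat_fact of_nat_mult)
    then show ?thesis
      using sz[OF that] by (simp add: field_simps)
  qed
  then have "(\<Sum>A\<in>\<A>. 1 / real (n choose card A)) =
      real (\<Sum>A\<in>\<A>. card {\<pi>\<in>?S. initial \<pi> (card A) = A}) / fact n"
    by (simp add: sum_divide_distrib)
  also have "(\<Sum>A\<in>\<A>. card {\<pi>\<in>?S. initial \<pi> (card A) = A}) =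
      (\<Sum>\<pi>\<in>?S. card {A\<in>\<A>. initial \<pi> (card A) = A})"
    using finS finA by (intro sum_multicount_gen) auto
  finally show ?thesis
    using members by simp
qed

text \<open>If \<open>R \<pi> C\<close> attaches at most one set \<open>C\<close> to each chain, exchanging the set of size \<open>card C\<close> on the
  chain is an involution on the chains that have such a \<open>C\<close>, since by \<open>swap\<close> the exchange leaves
  \<open>C\<close> attached. It moves every chain through its \<open>C\<close> off it. The bounds on \<open>card C\<close> guarantee that
  there is something to exchange: the two ends of a chain are fixed.\<close>

lemma card_through_le_half:
  fixes R :: "(nat \<Rightarrow> nat) \<Rightarrow> nat set \<Rightarrow> bool"
  assumes unique: "\<And>\<pi> C C'. \<pi> permutes {1..n} \<Longrightarrow> R \<pi> C \<Longrightarrow> R \<pi> C' \<Longrightarrow> C = C'"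
    and size: "\<And>\<pi> C. \<pi> permutes {1..n} \<Longrightarrow> R \<pi> C \<Longrightarrow> 1 \<le> card C \<and> card C < n"
    and swap: "\<And>\<pi> C. \<pi> permutes {1..n} \<Longrightarrow> R \<pi> C \<Longrightarrow>
      R (\<pi> \<circ> transpose (card C) (Suc (card C))) C"
  shows "2 * card {\<pi>. \<pi> permutes {1..n} \<and> (\<exists>C. R \<pi> C \<and> initial \<pi> (card C) = C)} \<le>
    card {\<pi>. \<pi> permutes {1..n} \<and> (\<exists>C. R \<pi> C)}"
    (is "2 * card ?T \<le> card ?G")
proof -
  define C where "C \<pi> = (SOME C. R \<pi> C)" for \<pi>
  define s where "s \<pi> = \<pi> \<circ> transpose (card (C \<pi>)) (Suc (card (C \<pi>)))" for \<pi>
  have R_C: "R \<pi> (C \<pi>)" if "\<pi> \<in> ?G" for \<pi>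
    using that unfolding C_def by (auto intro: someI)
  have C_eq: "C \<pi> = X" if "\<pi> permutes {1..n}" "R \<pi> X" for \<pi> X
    using that unique R_C by blast
  have s_G: "s \<pi> \<in> ?G" and C_s: "C (s \<pi>) = C \<pi>" if "\<pi> \<in> ?G" for \<pi>
  proof -
    have "s \<pi> permutes {1..n}"
      unfolding s_def using that size[OF _ R_C[OF that]]
      by (intro permutes_compose permutes_swap_id) auto
    moreover have "R (s \<pi>) (C \<pi>)"
      unfolding s_def using that swap R_C by blast
    ultimately show "s \<pi> \<in> ?G" "C (s \<pi>) = C \<pi>"
      using C_eq by auto
  qed
  have s_s: "s (s \<pi>) = \<pi>" if "\<pi> \<in> ?G" for \<pi>
  proof -
    have "s (s \<pi>) = s \<pi> \<circ> transpose (card (C \<pi>)) (Suc (card (C \<pi>)))"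
      by (simp only: s_def[of "s \<pi>"] C_s[OF that])
    then show ?thesis by (simp add: s_def o_assoc [symmetric])
  qed
  have avoid: "s \<pi> \<notin> ?T" if "\<pi> \<in> ?T" for \<pi>
  proof
    have G: "\<pi> \<in> ?G" using that by blast
    have "initial \<pi> (card (C \<pi>)) = C \<pi>"
      using that C_eq by auto
    moreover assume "s \<pi> \<in> ?T"
    then have "initial (s \<pi>) (card (C \<pi>)) = C \<pi>"
      using C_eq C_s[OF G] by auto
    ultimately show False
      using initial_transpose_changes[of \<pi> "{1..n}" "card (C \<pi>)"] size[OF _ R_C[OF G]] G
      unfolding s_def by auto
  qed
  have fin: "finite ?G"
    by (rule finite_subset[OF _ finite_permutations[of "{1..n}"]]) auto
  have TG: "?T \<subseteq> ?G" by blast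
  have "card ?T \<le> card (?G - ?T)"
  proof (rule card_inj_on_le[where f = s])
    show "inj_on s ?T" using s_s TG by (metis (no_types, lifting) inj_on_def subsetD)
    show "s ` ?T \<subseteq> ?G - ?T" using s_G avoid TG by blast
    show "finite (?G - ?T)" using fin by simp
  qed
  moreover have "card (?G - ?T) = card ?G - card ?T" "card ?T \<le> card ?G"
    using TG fin by (auto intro: card_Diff_subset card_mono finite_subset)
  ultimately show ?thesis by linarith
qed

section \<open>Copies of the forked poset\<close>

text \<open>Stated for an arbitrary strict order \<open>R\<close>, so that \<open>\<subset>\<close> and \<open>\<supset>\<close> give the two posets at once.\<close>

lemma Y_embedding:
  assumes trans: "transp R" and irrefl: "irreflp R"
    and stem: "\<And>i. i \<in> {1..k} \<Longrightarrow> f i \<in> \<A>"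
    and step: "\<And>i j. 1 \<le> i \<Longrightarrow> i < j \<Longrightarrow> j \<le> k \<Longrightarrow> R (f i) (f j)"
    and tips: "y \<in> \<A>" "z \<in> \<A>" "R (f k) y" "R (f k) z" "y \<noteq> z"
    and "1 \<le> k"
  obtains \<phi> where "inj_on \<phi> (Y_carrier k)" "\<phi> ` Y_carrier k \<subseteq> \<A>"
    "\<And>a b. (a, b) \<in> Y_order k \<Longrightarrow> R (\<phi> a) (\<phi> b) \<or> \<phi> a = \<phi> b"
proof
  define \<phi> where "\<phi> a = (case a of Stem i \<Rightarrow> f i | Tip_y \<Rightarrow> y | Tip_z \<Rightarrow> z)" for a
  have neq: "a \<noteq> b" if "R a b" for a b
    using that irrefl by (auto simp: irreflp_def)
  have below: "R (f i) y" "R (f i) z" if "i \<in> {1..k}" for i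
    using that step[of i k] tips trans by (cases "i = k"; auto dest: transpD)+
  have stem_inj: "i = j" if "f i = f j" "i \<in> {1..k}" "j \<in> {1..k}" for i j
    using that step neq by (metis atLeastAtMost_iff nat_neq_iff)
  show "inj_on \<phi> (Y_carrier k)"
    unfolding inj_on_def Y_carrier_def
    using stem_inj below neq \<open>y \<noteq> z\<close> by (fastforce simp: \<phi>_def)
  show "\<phi> ` Y_carrier k \<subseteq> \<A>"
    using stem tips by (auto simp: \<phi>_def Y_carrier_def)
  fix a b assume "(a, b) \<in> Y_order k"
  then have "(a, b) \<in> (Y_gen k)\<^sup>*" by (simp add: Y_order_def)
  then show "R (\<phi> a) (\<phi> b) \<or> \<phi> a = \<phi> b"
  proof induction
    case (step b c)
    have "R (\<phi> b) (\<phi> c)"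
      using step.hyps(2) tips assms(4) by (auto simp: Y_gen_def \<phi>_def)
    with step.IH trans show ?case by (auto dest: transpD)
  qed simp
qed

lemma contains_YI:
  assumes "\<And>i. i \<in> {1..k} \<Longrightarrow> f i \<in> \<A>"
    and "\<And>i j. 1 \<le> i \<Longrightarrow> i < j \<Longrightarrow> j \<le> k \<Longrightarrow> f i \<subset> f j"
    and "y \<in> \<A>" "z \<in> \<A>" "f k \<subset> y" "f k \<subset> z" "y \<noteq> z" "1 \<le> k"
  shows "contains_Y \<A> k"
proof -
  obtain \<phi> where "inj_on \<phi> (Y_carrier k)" "\<phi> ` Y_carrier k \<subseteq> \<A>"
    "\<And>a b. (a, b) \<in> Y_order k \<Longrightarrow> \<phi> a \<subset> \<phi> b \<or> \<phi> a = \<phi> b"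
    by (rule Y_embedding[of "(\<subset>)" k f \<A> y z]) (use assms in \<open>auto simp: transp_def irreflp_def\<close>)
  then show ?thesis
    unfolding contains_Y_def weak_subposet_def relation_of_def by blast
qed

lemma contains_Y_dualI:
  assumes "\<And>i. i \<in> {1..k} \<Longrightarrow> f i \<in> \<A>"
    and "\<And>i j. 1 \<le> i \<Longrightarrow> i < j \<Longrightarrow> j \<le> k \<Longrightarrow> f j \<subset> f i"
    and "y \<in> \<A>" "z \<in> \<A>" "y \<subset> f k" "z \<subset> f k" "y \<noteq> z" "1 \<le> k"
  shows "contains_Y_dual \<A> k"
proof -
  obtain \<phi> where "inj_on \<phi> (Y_carrier k)" "\<phi> ` Y_carrier k \<subseteq> \<A>"
    "\<And>a b. (a, b) \<in> Y_order k \<Longrightarrow> \<phi> b \<subset> \<phi> a \<or> \<phi> a = \<phi> b"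
    by (rule Y_embedding[of "(\<supset>)" k f \<A> y z]) (use assms in \<open>auto simp: transp_def irreflp_def\<close>)
  then show ?thesis
    unfolding contains_Y_dual_def weak_subposet_def relation_of_def by blast
qed

section \<open>Spines\<close>

text \<open>The condition mentions \<open>\<pi>\<close> only through the sets of its chain between \<open>B\<close> and \<open>D\<close>; this is
  what makes it stable under the exchange at \<open>C\<close> or \<open>E\<close>.\<close>

definition spine :: "nat set set \<Rightarrow> nat \<Rightarrow> (nat \<Rightarrow> nat) \<Rightarrow>
    nat set \<Rightarrow> nat set \<Rightarrow> nat set \<Rightarrow> nat set \<Rightarrow> bool" where
  "spine \<A> k \<pi> C B D E \<longleftrightarrow>
    {X\<in>\<A>. X \<subset> B} = {C} \<and> {X\<in>\<A>. D \<subset> X} = {E} \<and> B \<in> \<A> \<and> D \<in> \<A> \<and> card B \<le> card D \<and>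
    initial \<pi> (card B) = B \<and> initial \<pi> (card D) = D \<and>
    card {i\<in>{card B..card D}. initial \<pi> i \<in> \<A>} = k - 1"

lemma spine_lower_iff: "spine \<A> k \<pi> C B D E \<Longrightarrow> X \<in> \<A> \<and> X \<subset> B \<longleftrightarrow> X = C"
  unfolding spine_def by (metis (mono_tags, lifting) mem_Collect_eq singleton_iff)

lemma spine_upper_iff: "spine \<A> k \<pi> C B D E \<Longrightarrow> X \<in> \<A> \<and> D \<subset> X \<longleftrightarrow> X = E"
  unfolding spine_def by (metis (mono_tags, lifting) mem_Collect_eq singleton_iff)

text \<open>If \<open>B \<subset> B'\<close> were the lower ends of two spines of one chain, then \<open>B'\<close> would have two members
  below it: \<open>B\<close> and the member below \<open>B\<close>. Dually for the upper ends.\<close>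

lemma spine_unique:
  assumes "spine \<A> k \<pi> C B D E" "spine \<A> k \<pi> C' B' D' E'"
  shows "C = C' \<and> B = B' \<and> D = D' \<and> E = E'"
proof -
  have chain: "X \<subseteq> X' \<or> X' \<subseteq> X" if "initial \<pi> (card X) = X" "initial \<pi> (card X') = X'" for X X'
    using that initial_mono[of "card X" "card X'" \<pi>] initial_mono[of "card X'" "card X" \<pi>]
    by (metis nat_le_linear)
  have no_lower: False if "spine \<A> k \<pi> C B D E" "spine \<A> k \<pi> C' B' D' E'" "B \<subset> B'"
    for C B D E C' B' D' E'
  proof -
    have "B \<in> \<A>" using that(1) by (simp add: spine_def)
    then have "B = C'" using spine_lower_iff[OF that(2)] that(3) by blast
    moreover have "C \<in> \<A>" "C \<subset> B" using spine_lower_iff[OF that(1)] by blast+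
    then have "C = C'" using spine_lower_iff[OF that(2)] that(3) by blast
    ultimately show False using \<open>C \<subset> B\<close> by simp
  qed
  have no_upper: False if "spine \<A> k \<pi> C B D E" "spine \<A> k \<pi> C' B' D' E'" "D \<subset> D'"
    for C B D E C' B' D' E'
  proof -
    have "D' \<in> \<A>" using that(2) by (simp add: spine_def)
    then have "D' = E" using spine_upper_iff[OF that(1)] that(3) by blast
    moreover have "E' \<in> \<A>" "D' \<subset> E'" using spine_upper_iff[OF that(2)] by blast+
    then have "E' = E" using spine_upper_iff[OF that(1)] that(3) by blast
    ultimately show False using \<open>D' \<subset> E'\<close> by simp
  qed
  have in_chain: "initial \<pi> (card B) = B" "initial \<pi> (card D) = D"
    "initial \<pi> (card B') = B'" "initial \<pi> (card D') = D'"
    using assms by (simp_all add: spine_def)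
  have "B = B'"
    using chain[of B B'] no_lower[OF assms] no_lower[OF assms(2,1)] in_chain by blast
  moreover have "D = D'"
    using chain[of D D'] no_upper[OF assms] no_upper[OF assms(2,1)] in_chain by blast
  ultimately show ?thesis
    using spine_lower_iff[OF assms(1), of C] spine_upper_iff[OF assms(1), of E]
      spine_lower_iff[OF assms(2), of C] spine_upper_iff[OF assms(2), of E]
    by simp
qed

lemma spine_transpose:
  assumes "spine \<A> k \<pi> C B D E" "1 \<le> i" "i < card B \<or> card D < i"
  shows "spine \<A> k (\<pi> \<circ> transpose i (Suc i)) C B D E"
proof -
  have "card B \<le> card D" using assms(1) by (simp add: spine_def)
  then have eq: "initial (\<pi> \<circ> transpose i (Suc i)) j = initial \<pi> j"
    if "j \<in> {card B..card D}" for j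
    using assms that by (intro initial_transpose_neq) auto
  then have "{j\<in>{card B..card D}. initial (\<pi> \<circ> transpose i (Suc i)) j \<in> \<A>} =
      {j\<in>{card B..card D}. initial \<pi> j \<in> \<A>}"
    by auto
  then show ?thesis
    using assms(1) \<open>card B \<le> card D\<close> eq unfolding spine_def by simp
qed

lemma spine_count:
  assumes \<pi>: "\<pi> permutes {1..n}" and "1 \<le> k" and sp: "spine \<A> k \<pi> C B D E"
  shows "card {i. i \<le> n \<and> initial \<pi> i \<in> \<A>} + 1 \<le>
    k + of_bool (initial \<pi> (card C) = C) + of_bool (initial \<pi> (card E) = E)"
proof -
  let ?M = "{i\<in>{card B..card D}. initial \<pi> i \<in> \<A>}"
  let ?c = "if initial \<pi> (card C) = C then {card C} else {}"
  let ?e = "if initial \<pi> (card E) = E then {card E} else {}"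
  have "{i. i \<le> n \<and> initial \<pi> i \<in> \<A>} \<subseteq> ?M \<union> (?c \<union> ?e)"
  proof
    fix i assume "i \<in> {i. i \<le> n \<and> initial \<pi> i \<in> \<A>}"
    then have i: "initial \<pi> i \<in> \<A>" by simp
    consider "i \<in> {card B..card D}" | "i < card B" | "card D < i" by force
    then show "i \<in> ?M \<union> (?c \<union> ?e)"
    proof cases
      case 2
      then have "initial \<pi> i \<subset> B"
        using sp initial_strict_mono[OF \<pi> 2] by (simp add: spine_def)
      then have "initial \<pi> i = C" using i spine_lower_iff[OF sp] by blast
      then show ?thesis using card_initial[OF \<pi>, of i] by auto
    next
      case 3
      then have "D \<subset> initial \<pi> i"
        using sp initial_strict_mono[OF \<pi> 3] by (simp add: spine_def)
      then have "initial \<pi> i = E" using i spine_upper_iff[OF sp] by blast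
      then show ?thesis using card_initial[OF \<pi>, of i] by auto
    qed (use i in auto)
  qed
  then have "card {i. i \<le> n \<and> initial \<pi> i \<in> \<A>} \<le> card (?M \<union> (?c \<union> ?e))"
    by (intro card_mono) auto
  also have "\<dots> \<le> card ?M + (card ?c + card ?e)"
    by (meson add_left_mono card_Un_le order_trans)
  also have "card ?M = k - 1" using sp by (simp add: spine_def)
  also have "card ?c = of_bool (initial \<pi> (card C) = C)"
    by simp
  also have "card ?e = of_bool (initial \<pi> (card E) = E)"
    by simp
  finally show ?thesis using \<open>1 \<le> k\<close> by linarith
qed

text \<open>The spine runs from the second to the \<open>k\<close>-th member of the chain. A second member of \<open>\<A>\<close>
  above the \<open>k\<close>-th one would complete the first \<open>k\<close> members to a copy of the forked poset; a second
  member below the second one would do so, dually, with the members number \<open>2\<close> to \<open>k + 1\<close>.\<close>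

lemma spine_exists:
  assumes \<pi>: "\<pi> permutes {1..n}" and k: "2 \<le> k"
    and noY: "\<not> contains_Y \<A> k" and noY': "\<not> contains_Y_dual \<A> k"
    and many: "k < card {i. i \<le> n \<and> initial \<pi> i \<in> \<A>}"
  shows "\<exists>C B D E. spine \<A> k \<pi> C B D E"
proof -
  define I where "I = {i. i \<le> n \<and> initial \<pi> i \<in> \<A>}"
  define xs where "xs = sorted_list_of_set I"
  have finI: "finite I" unfolding I_def by simp
  have set_xs: "set xs = I" and len: "k < length xs"
    using finI many by (simp_all add: xs_def I_def)
  have sorted: "sorted_wrt (<) xs" by (simp add: xs_def)
  have less: "xs ! i < xs ! j" if "i < j" "j < length xs" for i j
    using sorted that by (simp add: sorted_wrt_nth_less)
  then have le: "xs ! i \<le> xs ! j" if "i \<le> j" "j < length xs" for i j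
    using that by (cases "i = j") (auto intro: less_imp_le)
  define c where "c i = initial \<pi> (xs ! i)" for i
  have c_in: "c i \<in> \<A>" if "i < length xs" for i
    using nth_mem[OF that] set_xs by (simp add: c_def I_def)
  have c_less: "c i \<subset> c j" if "i < j" "j < length xs" for i j
    unfolding c_def using less[OF that] by (rule initial_strict_mono[OF \<pi>])
  have ends: "0 < length xs" "1 < length xs" "k - 1 < length xs"
    using k len by linarith+
  have card_c: "card (c i) = xs ! i" for i
    by (simp add: c_def card_initial[OF \<pi>])
  \<comment> \<open>List indices start at \<open>0\<close>: the second member is \<open>c 1\<close>, the \<open>k\<close>-th one \<open>c (k - 1)\<close>.\<close>
  have upper: "{X\<in>\<A>. c (k - 1) \<subset> X} = {c k}"
  proof (rule ccontr)
    have "c k \<in> {X\<in>\<A>. c (k - 1) \<subset> X}" using k len c_in c_less by simp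
    moreover assume "{X\<in>\<A>. c (k - 1) \<subset> X} \<noteq> {c k}"
    ultimately obtain z where "z \<in> \<A>" "c (k - 1) \<subset> z" "z \<noteq> c k" by blast
    then have "contains_Y \<A> k"
      using k len by (intro contains_YI[where f = "\<lambda>i. c (i - 1)" and y = "c k" and z = z])
        (auto intro!: c_in c_less)
    with noY show False by simp
  qed
  have lower: "{X\<in>\<A>. X \<subset> c 1} = {c 0}"
  proof (rule ccontr)
    have "c 0 \<in> {X\<in>\<A>. X \<subset> c 1}" using ends c_in c_less by simp
    moreover assume "{X\<in>\<A>. X \<subset> c 1} \<noteq> {c 0}"
    ultimately obtain z where "z \<in> \<A>" "z \<subset> c 1" "c 0 \<noteq> z" by blast
    moreover have "c (Suc k - i) \<in> \<A>" if "i \<in> {1..k}" for i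
      using that len by (intro c_in) auto
    moreover have "c (Suc k - j) \<subset> c (Suc k - i)" if "1 \<le> i" "i < j" "j \<le> k" for i j
      using that len by (intro c_less) auto
    ultimately have "contains_Y_dual \<A> k"
      using k ends c_in c_less
      by (intro contains_Y_dualI[where f = "\<lambda>i. c (Suc k - i)" and y = "c 0" and z = z]) simp_all
    with noY' show False by simp
  qed
  have "{i\<in>{xs ! 1..xs ! (k - 1)}. initial \<pi> i \<in> \<A>} = (!) xs ` {1..k - 1}"
  proof (intro equalityI subsetI)
    fix i assume "i \<in> {i\<in>{xs ! 1..xs ! (k - 1)}. initial \<pi> i \<in> \<A>}"
    then have i: "xs ! 1 \<le> i" "i \<le> xs ! (k - 1)" "initial \<pi> i \<in> \<A>" by auto
    have "xs ! (k - 1) \<in> I" using set_xs nth_mem[of "k - 1" xs] len by simp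
    then have "i \<in> set xs" using i set_xs by (simp add: I_def)
    then obtain j where j: "j < length xs" "i = xs ! j" by (auto simp: in_set_conv_nth)
    have "1 \<le> j" using less[of j 1] i(1) j len k by (cases "j < 1") auto
    moreover have "j \<le> k - 1" using less[of "k - 1" j] i(2) j by (cases "k - 1 < j") auto
    ultimately show "i \<in> (!) xs ` {1..k - 1}" using j by auto
  next
    fix i assume "i \<in> (!) xs ` {1..k - 1}"
    then obtain j where j: "i = xs ! j" "1 \<le> j" "j \<le> k - 1" by auto
    have "xs ! 1 \<le> xs ! j" "xs ! j \<le> xs ! (k - 1)"
      using j ends by (auto intro!: le)
    then show "i \<in> {i\<in>{xs ! 1..xs ! (k - 1)}. initial \<pi> i \<in> \<A>}"
      using c_in[of j] j len by (simp add: c_def)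
  qed
  moreover have "inj_on ((!) xs) {1..k - 1}"
    by (rule inj_on_nth) (use len in \<open>auto simp: xs_def\<close>)
  ultimately have "card {i\<in>{xs ! 1..xs ! (k - 1)}. initial \<pi> i \<in> \<A>} = k - 1"
    by (simp add: card_image)
  moreover have "xs ! 1 \<le> xs ! (k - 1)"
    using k ends by (intro le) auto
  ultimately have "spine \<A> k \<pi> (c 0) (c 1) (c (k - 1)) (c k)"
    using upper lower c_in k len by (simp add: spine_def card_c) (simp add: c_def)
  then show ?thesis by blast
qed

section \<open>The weighted bound\<close>

theorem theorem5:
  fixes k n :: nat and \<A> :: "nat set set"
  assumes "k \<ge> 2" and "n \<ge> k + 1"
    and "\<A> \<subseteq> Pow {1..n}"
    and "\<not> contains_Y \<A> k" and "\<not> contains_Y_dual \<A> k"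
    and "{} \<notin> \<A>" and "{1..n} \<notin> \<A>"
  shows "(\<Sum>A\<in>\<A>. 1 / real (n choose card A)) \<le> real k"
proof -
  let ?S = "{\<pi>. \<pi> permutes {1..n}}"
  let ?members = "\<lambda>\<pi>. card {i. i \<le> n \<and> initial \<pi> i \<in> \<A>}"
  define lower where "lower \<pi> C \<longleftrightarrow> (\<exists>B D E. spine \<A> k \<pi> C B D E)" for \<pi> C
  define upper where "upper \<pi> E \<longleftrightarrow> (\<exists>C B D. spine \<A> k \<pi> C B D E)" for \<pi> E
  define spined where "spined \<pi> \<longleftrightarrow> (\<exists>C. lower \<pi> C)" for \<pi>
  define through_C where "through_C \<pi> \<longleftrightarrow> (\<exists>C. lower \<pi> C \<and> initial \<pi> (card C) = C)" for \<pi>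
  define through_E where "through_E \<pi> \<longleftrightarrow> (\<exists>E. upper \<pi> E \<and> initial \<pi> (card E) = E)" for \<pi>
  have finS: "finite ?S" by (simp add: finite_permutations)
  have fin: "finite A" if "A \<in> \<A>" for A
    using that assms(3) finite_subset by blast
  have size: "1 \<le> card A \<and> card A < n" if "A \<in> \<A>" for A
  proof
    have "A \<noteq> {}" using that assms(6) by auto
    then show "1 \<le> card A" using fin[OF that] by (simp add: Suc_le_eq card_gt_0_iff)
    have "A \<subset> {1..n}" using that assms(3,7) by auto
    then show "card A < n" using psubset_card_mono[of "{1..n}" A] by simp
  qed
  have leaves: "C \<in> \<A>" "card C < card B" "E \<in> \<A>" "card D < card E"
    if "spine \<A> k \<pi> C B D E" for \<pi> C B D E
  proof -
    have "C \<in> \<A> \<and> C \<subset> B" "E \<in> \<A> \<and> D \<subset> E"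
      using spine_lower_iff[OF that, of C] spine_upper_iff[OF that, of E] by simp_all
    moreover have "B \<in> \<A>"
      using that by (simp add: spine_def)
    ultimately show "C \<in> \<A>" "card C < card B" "E \<in> \<A>" "card D < card E"
      using fin by (auto intro: psubset_card_mono)
  qed
  have half_C: "2 * card {\<pi>. \<pi> permutes {1..n} \<and> through_C \<pi>} \<le>
      card {\<pi>. \<pi> permutes {1..n} \<and> spined \<pi>}"
    unfolding through_C_def spined_def
  proof (rule card_through_le_half)
    fix \<pi> C assume "lower \<pi> C"
    then obtain B D E where sp: "spine \<A> k \<pi> C B D E" by (auto simp: lower_def)
    show "1 \<le> card C \<and> card C < n" using size leaves(1)[OF sp] .
    then show "lower (\<pi> \<circ> transpose (card C) (Suc (card C))) C"
      unfolding lower_def using spine_transpose[OF sp] leaves(2)[OF sp] by blast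
  qed (auto simp only: lower_def dest: spine_unique)
  have "2 * card {\<pi>. \<pi> permutes {1..n} \<and> through_E \<pi>} \<le>
      card {\<pi>. \<pi> permutes {1..n} \<and> (\<exists>E. upper \<pi> E)}"
    unfolding through_E_def
  proof (rule card_through_le_half)
    fix \<pi> E assume "upper \<pi> E"
    then obtain C B D where sp: "spine \<A> k \<pi> C B D E" by (auto simp: upper_def)
    show "1 \<le> card E \<and> card E < n" using size leaves(3)[OF sp] .
    then show "upper (\<pi> \<circ> transpose (card E) (Suc (card E))) E"
      unfolding upper_def using spine_transpose[OF sp] leaves(4)[OF sp] by blast
  qed (auto simp only: upper_def dest: spine_unique)
  moreover have "(\<exists>E. upper \<pi> E) \<longleftrightarrow> spined \<pi>" for \<pi>
    by (auto simp: upper_def spined_def lower_def)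
  ultimately have half_E: "2 * card {\<pi>. \<pi> permutes {1..n} \<and> through_E \<pi>} \<le>
      card {\<pi>. \<pi> permutes {1..n} \<and> spined \<pi>}"
    by simp
  have "?members \<pi> + of_bool (spined \<pi>) \<le> k + of_bool (through_C \<pi>) + of_bool (through_E \<pi>)"
    if "\<pi> \<in> ?S" for \<pi>
  proof (cases "spined \<pi>")
    case True
    then obtain C B D E where sp: "spine \<A> k \<pi> C B D E" by (auto simp: spined_def lower_def)
    have "initial \<pi> (card C) = C \<Longrightarrow> through_C \<pi>" "initial \<pi> (card E) = E \<Longrightarrow> through_E \<pi>"
      using sp by (auto simp: through_C_def through_E_def lower_def upper_def)
    then have "of_bool (initial \<pi> (card C) = C) + of_bool (initial \<pi> (card E) = E) \<le>
        of_bool (through_C \<pi>) + (of_bool (through_E \<pi>) :: nat)"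
      by (intro add_mono) auto
    moreover have "?members \<pi> + 1 \<le>
        k + of_bool (initial \<pi> (card C) = C) + of_bool (initial \<pi> (card E) = E)"
      using that assms(1) sp by (intro spine_count) auto
    ultimately show ?thesis using True by simp
  next
    case False
    then have "?members \<pi> \<le> k"
      using spine_exists[of \<pi> n k \<A>] that assms(1,4,5)
      by (auto simp: spined_def lower_def not_less [symmetric])
    with False show ?thesis by simp
  qed
  then have "(\<Sum>\<pi>\<in>?S. ?members \<pi> + of_bool (spined \<pi>)) \<le>
      (\<Sum>\<pi>\<in>?S. k + of_bool (through_C \<pi>) + of_bool (through_E \<pi>))"
    by (rule sum_mono)
  then have "(\<Sum>\<pi>\<in>?S. ?members \<pi>) + card {\<pi>\<in>?S. spined \<pi>} \<le>
      k * card ?S + card {\<pi>\<in>?S. through_C \<pi>} + card {\<pi>\<in>?S. through_E \<pi>}"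
    using finS by (simp add: sum.distrib sum_of_bool_eq Int_def mult.commute)
  moreover have "card ?S = fact n"
    by (rule card_permutations) auto
  ultimately have "(\<Sum>\<pi>\<in>?S. ?members \<pi>) \<le> k * fact n"
    using half_C half_E by simp
  then have "real (\<Sum>\<pi>\<in>?S. ?members \<pi>) \<le> real (k * fact n)"
    by (rule of_nat_mono)
  then have "real (\<Sum>\<pi>\<in>?S. ?members \<pi>) \<le> real k * fact n"
    by (simp only: of_nat_mult of_nat_fact)
  then show ?thesis
    unfolding sum_inverse_choose_eq_average[OF assms(3)] by (simp add: divide_le_eq)
qed

end
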